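(* Let $X$ be any random vector taking values in $\mathbb{R}^n$. Let $T \subset \mathbb{R}^n$ be any nonempty origin-symmetric set and let $u>0$ be any number. Let $$r > 2u \cdot \widetilde{w}_X(T).$$ Then there exists a Borel set $A \subset \mathbb{R}^n$ such that $$\mathbb{P}\{X \in A\} > 1-\frac1u \quad \text{and} \quad \mathbb{P}\{X \in A-rT\} < \frac1u.$$
   Context: A set $S\subset\mathbb{R}^n$ is origin-symmetric if $S=-S$. For a random vector $X$ in $\mathbb{R}^n$ and a nonempty origin-symmetric set $S\subset\mathbb{R}^n$, the $X$-width of $S$ is $w_X(S) = \mathbb{E} \sup_{s \in S} \langle X, s\rangle \in [0,\infty]$. The focused $X$-width of $T$ is $$\widetilde{w}_X(T) = \inf_S w_X(S),$$ where the infimum is over all origin-symmetric sets $S \subset \mathbb{R}^n$ such that for every $t \in T$ there exists $s \in S$ with $\langle t, s\rangle \ge 1$ (the infimum over the empty family being $+\infty$). For $A,T\subset\mathbb{R}^n$ and $r\in\mathbb{R}$, $A-rT = \{a-rt : a\in A,\ t\in T\}$. If $A-rT$ is not measurable, $\mathbb{P}\{X\in A-rT\}$ is understood as outer probability. *)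

theory Defs
  imports "HOL-Probability.Probability"
begin

definition origin_symmetric :: "(real ^ 'n) set \<Rightarrow> bool" where
  "origin_symmetric S \<longleftrightarrow> S = uminus ` S"

text \<open>The supremum is taken in the extended reals. For nonempty origin-symmetric \<open>S\<close> it is
  nonnegative, because \<open>S\<close> contains \<open>- s\<close> with each \<open>s\<close>, so \<^const>\<open>e2ennreal\<close> truncates nothing.
  It is a lower semicontinuous function of the value of \<open>X\<close>, hence measurable for every \<open>S\<close>,
  countable or not, so the nonnegative integral is the expectation.\<close>

definition X_width :: "'a measure \<Rightarrow> ('a \<Rightarrow> real ^ 'n) \<Rightarrow> (real ^ 'n) set \<Rightarrow> ennreal" where
  "X_width M X S = (\<integral>\<^sup>+ \<omega>. e2ennreal (SUP s\<in>S. ereal (X \<omega> \<bullet> s)) \<partial>M)"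

definition focused_X_width :: "'a measure \<Rightarrow> ('a \<Rightarrow> real ^ 'n) \<Rightarrow> (real ^ 'n) set \<Rightarrow> ennreal" where
  "focused_X_width M X T =
     (INF S \<in> {S. origin_symmetric S \<and> (\<forall>t\<in>T. \<exists>s\<in>S. t \<bullet> s \<ge> 1)}. X_width M X S)"

end

theory Submission
  imports Defs
begin

text \<open>Markov's inequality applied to the support function of a near-optimal \<open>S\<close> gives
  \<open>A = {x. sup\<^sub>S \<langle>x, s\<rangle> < r / 2}\<close>. If \<open>x = a - r t\<close> with \<open>a \<in> A\<close> and \<open>\<langle>t, s\<rangle> \<ge> 1\<close>, then
  \<open>\<langle>x, - s\<rangle> > r / 2\<close>, so \<open>A - r T\<close> is contained in the complement of \<open>A\<close>.\<close>

text \<open>Naming the integrand of \<open>X_width\<close> as a function of the point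
  \<open>x\<close> lets its measurability be proved on the Borel space and then composed with
  \<open>X\<close>.\<close>

definition support_fun :: "('b :: real_inner) set \<Rightarrow> 'b \<Rightarrow> ennreal" where
  "support_fun S x = e2ennreal (SUP s\<in>S. ereal (x \<bullet> s))"

lemma X_width_eq_support_fun: "X_width M X S = (\<integral>\<^sup>+ \<omega>. support_fun S (X \<omega>) \<partial>M)"
  by (simp add: X_width_def support_fun_def)

lemma inner_le_support_fun: "s \<in> S \<Longrightarrow> ennreal (x \<bullet> s) \<le> support_fun S x"
  unfolding support_fun_def e2ennreal_ereal[symmetric]
  by (intro e2ennreal_mono SUP_upper)

text \<open>Each strict superlevel set of the supremum is a union of open half-spaces, empty sets or
  whole spaces, so it is open however large \<open>S\<close> is.\<close>

lemma borel_measurable_support_fun [measurable]: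
  fixes S :: "('b :: real_inner) set"
  shows "support_fun S \<in> borel_measurable borel"
proof -
  have "(\<lambda>x. SUP s\<in>S. ereal (x \<bullet> s)) \<in> borel_measurable borel"
  proof (rule borel_measurableI_greater)
    fix c
    have "open {x :: 'b. c < ereal (x \<bullet> s)}" for s
      by (intro open_Collect_less continuous_intros)
    moreover have "{x. c < (SUP s\<in>S. ereal (x \<bullet> s))} = (\<Union>s\<in>S. {x. c < ereal (x \<bullet> s)})"
      by (auto simp: less_SUP_iff)
    ultimately show "{x \<in> space borel. c < (SUP s\<in>S. ereal (x \<bullet> s))} \<in> sets borel"
      by (auto intro!: borel_open)
  qed
  then show ?thesis
    unfolding support_fun_def[abs_def] by measurable
qed

lemma focused_X_width_lessE:
  assumes "focused_X_width M X T < c"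
  obtains S where "origin_symmetric S" "\<And>t. t \<in> T \<Longrightarrow> \<exists>s\<in>S. t \<bullet> s \<ge> 1" "X_width M X S < c"
  using assms unfolding focused_X_width_def INF_less_iff by auto

lemma origin_symmetric_uminus: "origin_symmetric S \<Longrightarrow> s \<in> S \<Longrightarrow> - s \<in> S"
  unfolding origin_symmetric_def by blast

theorem theorem5p3:
  fixes M :: "'a measure" and X :: "'a \<Rightarrow> real ^ 'n" and T :: "(real ^ 'n) set" and u r :: real
  assumes "prob_space M"
    and "X \<in> borel_measurable M"
    and "T \<noteq> {}"
    and "origin_symmetric T"
    and "u > 0"
    and "ennreal r > ennreal (2 * u) * focused_X_width M X T"
  shows "\<exists>A \<in> sets borel.
    \<P>(\<omega> in M. X \<omega> \<in> A) > 1 - 1 / u \<and>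
    outer_measure_of M {\<omega> \<in> space M. X \<omega> \<in> {a - r *\<^sub>R t | a t. a \<in> A \<and> t \<in> T}} < ennreal (1 / u)"
proof -
  interpret prob_space M by fact
  note [measurable] = assms(2)
  \<comment> \<open>\<open>ennreal\<close> sends nonpositive reals to 0, which cannot strictly
    exceed anything.\<close>
  have r: "r > 0"
    using le_less_trans[OF zero_le assms(6)] by simp
  \<comment> \<open>Only the positive finite factor is cancelled, so \<open>w\<close> may be
    infinite.\<close>
  have cancel: "ennreal (1 / (2 * u)) * (ennreal (2 * u) * w) = w" for w
    using \<open>u > 0\<close> by (simp add: mult.assoc[symmetric] ennreal_mult[symmetric])
  have "focused_X_width M X T < ennreal (r / (2 * u))"
    using ennreal_mult_strict_left_mono[OF assms(6), of "ennreal (1 / (2 * u))"] \<open>u > 0\<close> r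
    by (simp add: cancel ennreal_mult[symmetric])
  then obtain S where S: "origin_symmetric S" "\<And>t. t \<in> T \<Longrightarrow> \<exists>s\<in>S. t \<bullet> s \<ge> 1"
    and width: "X_width M X S < ennreal (r / (2 * u))"
    by (rule focused_X_width_lessE) blast
  \<comment> \<open>The scaling by \<open>2 / r\<close> puts \<open>B\<close> in the form of
    Markov's inequality with threshold 1; \<open>B\<close> is the event that \<open>X\<close> misses
    \<open>A\<close>.\<close>
  define A where "A = {x. ennreal (2 / r) * support_fun S x < 1}"
  define B where "B = {\<omega> \<in> space M. 1 \<le> ennreal (2 / r) * support_fun S (X \<omega>)}"
  have [measurable]: "A \<in> sets borel" "B \<in> sets M"
    unfolding A_def B_def by measurable
  have "emeasure M B \<le> ennreal (2 / r) * (\<integral>\<^sup>+ \<omega>. support_fun S (X \<omega>) * indicator (space M) \<omega> \<partial>M)"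
    unfolding B_def by (rule nn_integral_Markov_inequality) auto
  also have "\<dots> = ennreal (2 / r) * X_width M X S"
    by (simp add: X_width_eq_support_fun cong: nn_integral_cong)
  also have "\<dots> < ennreal (2 / r) * ennreal (r / (2 * u))"
    using r width by (intro ennreal_mult_strict_left_mono) auto
  also have "\<dots> = ennreal (1 / u)"
    using r \<open>u > 0\<close> by (simp add: ennreal_mult[symmetric])
  finally have B: "emeasure M B < ennreal (1 / u)" .
  have "{\<omega> \<in> space M. X \<omega> \<in> A} = space M - B"
    by (auto simp: A_def B_def not_le)
  then have "\<P>(\<omega> in M. X \<omega> \<in> A) > 1 - 1 / u"
    using B \<open>u > 0\<close> by (simp add: prob_compl emeasure_eq_measure ennreal_less_iff)
  moreover have "{\<omega> \<in> space M. X \<omega> \<in> {a - r *\<^sub>R t | a t. a \<in> A \<and> t \<in> T}} \<subseteq> B"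
  proof safe
    fix \<omega> a t
    assume *: "\<omega> \<in> space M" "X \<omega> = a - r *\<^sub>R t" "a \<in> A" "t \<in> T"
    obtain s where s: "s \<in> S" "t \<bullet> s \<ge> 1"
      using S(2)[OF \<open>t \<in> T\<close>] by blast
    have "ennreal (2 / r) * ennreal (a \<bullet> s) < 1"
      using * s by (auto simp: A_def intro: le_less_trans[OF mult_left_mono[OF inner_le_support_fun]])
    \<comment> \<open>Clipping negative values to 0 does not affect a comparison with the positive
      bound 1.\<close>
    then have "2 / r * (a \<bullet> s) < 1"
      using r by (simp add: ennreal_mult'[symmetric] del: times_divide_eq_left)
    \<comment> \<open>The shift by \<open>r *\<^sub>R t\<close> costs at least 2 in the scaled inner
      product; starting below 1, it ends below -1, and the sign flips with
      \<open>- s\<close>.\<close>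
    moreover have "2 / r * (r * (t \<bullet> s)) \<ge> 2"
      using s r by simp
    ultimately have "1 \<le> 2 / r * (X \<omega> \<bullet> (- s))"
      by (simp add: * inner_diff_left right_diff_distrib)
    then have "1 \<le> ennreal (2 / r) * ennreal (X \<omega> \<bullet> (- s))"
      using r by (simp add: ennreal_mult'[symmetric] del: times_divide_eq_left inner_minus_right)
    also have "\<dots> \<le> ennreal (2 / r) * support_fun S (X \<omega>)"
      by (intro mult_left_mono inner_le_support_fun origin_symmetric_uminus S s) simp
    finally show "\<omega> \<in> B"
      using * by (simp add: B_def)
  qed
  \<comment> \<open>The outer measure is an infimum over measurable supersets, and \<open>B\<close>
    is one of them.\<close>
  then have "outer_measure_of M {\<omega> \<in> space M. X \<omega> \<in> {a - r *\<^sub>R t | a t. a \<in> A \<and> t \<in> T}}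
      \<le> emeasure M B"
    unfolding outer_measure_of_def by (intro INF_lower) auto
  ultimately show ?thesis
    using B by (intro bexI[of _ A]) auto
qed

end
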